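(* Let $R$ be a Noetherian, excellent, reduced, $F$-finite ring containing a field of characteristic $p>0$, and let $\mathfrak a\subseteq R$ be an ideal with $\mathfrak a\cap R^\circ\neq\emptyset$. Suppose that $(R,\mathfrak a^{\operatorname{fpt}(\mathfrak a)})$ is a sharply $F$-pure pair. Then $\operatorname{fpt}(\mathfrak a)$ is a rational number and, furthermore, there exists some $e>0$ such that $\operatorname{fpt}(\mathfrak a)(p^e-1)\in\mathbb Z$. In other words, $\operatorname{fpt}(\mathfrak a)$ can be written as a quotient $m/n$ where $m,n\in\mathbb Z$ and $p$ does not divide $n$.
   Context: Rings are commutative with unit. $R^\circ$ is the set of elements of $R$ not contained in any minimal prime of $R$. Convention: $\mathfrak a^0=R$, and the definitions below are used also for exponent $s=0$. $R^{1/p^e}$ is the ring of $p^e$-th roots of elements of the reduced ring $R$, regarded as an $R$-module via $F^e:R\subseteq R^{1/p^e}$. For $f\in R$, $f^{1/p^e}F^e:R\to R^{1/p^e}$ is the $R$-linear map sending $1$ to $f^{1/p^e}$; it splits if it has an $R$-linear left inverse. For real $s\ge0$: $(R,\mathfrak a^s)$ is $F$-pure if for every $e\gg0$ there exists $f\in\mathfrak a^{\lfloor s(p^e-1)\rfloor}$ such that $f^{1/p^e}F^e$ splits. $(R,\mathfrak a^s)$ is strongly $F$-pure if there exists $e>0$ (equivalently, for all $e\gg0$) and $f\in\mathfrak a^{\lceil sp^e\rceil}$ such that $f^{1/p^e}F^e$ splits. $(R,\mathfrak a^s)$ is sharply $F$-pure if there exist infinitely many integers $e\ge0$ and associated elements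 $f_e\in\mathfrak a^{\lceil s(p^e-1)\rceil}$ such that each map $f_e^{1/p^e}F^e$ splits. The $F$-pure threshold is $\operatorname{fpt}(\mathfrak a)=\sup\{s\in\mathbb R_{\ge0}\mid (R,\mathfrak a^s)\text{ is }F\text{-pure}\}=\sup\{s\in\mathbb R_{\ge0}\mid (R,\mathfrak a^s)\text{ is strongly }F\text{-pure}\}$ (equality of the two suprema is a known result of Takagi and Watanabe). The hypothesis on $(R,\mathfrak a^{\operatorname{fpt}(\mathfrak a)})$ presupposes that $\operatorname{fpt}(\mathfrak a)$ is a (finite, nonnegative) real number. *)

theory Defs
  imports "HOL-Algebra.Indexed_Polynomials" "HOL-Algebra.Ideal_Product" "HOL-Library.Extended_Real"
    "HOL-Library.Extended_Nat"
begin

section \<open>General commutative algebra\<close>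

definition reduced_ring :: "('a, 'm) ring_scheme \<Rightarrow> bool" where
  "reduced_ring R \<longleftrightarrow> cring R \<and>
     (\<forall>x\<in>carrier R. \<forall>n::nat. x [^]\<^bsub>R\<^esub> n = \<zero>\<^bsub>R\<^esub> \<longrightarrow> x = \<zero>\<^bsub>R\<^esub>)"

text \<open>The identity of a subfield is that of the ring, so the characteristic can be read off
  from the multiples of \<^term>\<open>\<one>\<^bsub>R\<^esub>\<close>.\<close>

definition contains_field_of_char :: "('a, 'm) ring_scheme \<Rightarrow> nat \<Rightarrow> bool" where
  "contains_field_of_char R p \<longleftrightarrow>
     (\<exists>K. subfield K R \<and> (\<forall>n::nat. [n] \<cdot>\<^bsub>R\<^esub> \<one>\<^bsub>R\<^esub> = \<zero>\<^bsub>R\<^esub> \<longleftrightarrow> p dvd n))"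

definition prime_spectrum :: "('a, 'm) ring_scheme \<Rightarrow> 'a set set" where
  "prime_spectrum R = {P. primeideal P R}"

definition minimal_primes :: "('a, 'm) ring_scheme \<Rightarrow> 'a set set" where
  "minimal_primes R =
     {P \<in> prime_spectrum R. \<forall>Q\<in>prime_spectrum R. Q \<subseteq> P \<longrightarrow> Q = P}"

text \<open>The set written \<open>R\<^sup>\<circ>\<close> in tight closure theory.\<close>

definition off_minimal_primes :: "('a, 'm) ring_scheme \<Rightarrow> 'a set" where
  "off_minimal_primes R = {x \<in> carrier R. \<forall>P\<in>minimal_primes R. x \<notin> P}"

definition prime_chain :: "('a, 'm) ring_scheme \<Rightarrow> nat \<Rightarrow> (nat \<Rightarrow> 'a set) \<Rightarrow> bool" where
  "prime_chain R n C \<longleftrightarrow>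
     (\<forall>i\<le>n. C i \<in> prime_spectrum R) \<and> (\<forall>i<n. C i \<subset> C (Suc i))"

definition saturated_prime_chain ::
    "('a, 'm) ring_scheme \<Rightarrow> nat \<Rightarrow> (nat \<Rightarrow> 'a set) \<Rightarrow> bool" where
  "saturated_prime_chain R n C \<longleftrightarrow> prime_chain R n C \<and>
     (\<forall>i<n. \<not> (\<exists>Q\<in>prime_spectrum R. C i \<subset> Q \<and> Q \<subset> C (Suc i)))"

definition krull_dim :: "('a, 'm) ring_scheme \<Rightarrow> enat" where
  "krull_dim R = Sup {enat n | n. \<exists>C. prime_chain R n C}"

definition catenary :: "('a, 'm) ring_scheme \<Rightarrow> bool" where
  "catenary R \<longleftrightarrow> (\<forall>P\<in>prime_spectrum R. \<forall>Q\<in>prime_spectrum R. P \<subseteq> Q \<longrightarrow>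
     (\<exists>N. \<forall>n C. prime_chain R n C \<and> C 0 = P \<and> C n = Q \<longrightarrow> n \<le> N) \<and>
     (\<forall>m n C D. saturated_prime_chain R m C \<and> C 0 = P \<and> C m = Q \<and>
                saturated_prime_chain R n D \<and> D 0 = P \<and> D n = Q \<longrightarrow> m = n))"


subsection \<open>Localization\<close>

definition loc_frac ::
    "('a, 'm) ring_scheme \<Rightarrow> 'a set \<Rightarrow> 'a \<Rightarrow> 'a \<Rightarrow> ('a \<times> 'a) set" where
  "loc_frac R S r s = {(r', s'). r' \<in> carrier R \<and> s' \<in> S \<and>
     (\<exists>u\<in>S. u \<otimes>\<^bsub>R\<^esub> ((r \<otimes>\<^bsub>R\<^esub> s') \<ominus>\<^bsub>R\<^esub> (r' \<otimes>\<^bsub>R\<^esub> s)) = \<zero>\<^bsub>R\<^esub>)}"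

text \<open>\<open>S\<close> is meant to be a multiplicative subset. The unions below run over all representatives;
  their members coincide.\<close>

definition localization ::
    "('a, 'm) ring_scheme \<Rightarrow> 'a set \<Rightarrow> ('a \<times> 'a) set ring" where
  "localization R S =
    \<lparr> carrier = {loc_frac R S r s | r s. r \<in> carrier R \<and> s \<in> S},
      monoid.mult = (\<lambda>U V. \<Union>x\<in>U. \<Union>y\<in>V. loc_frac R S (fst x \<otimes>\<^bsub>R\<^esub> fst y) (snd x \<otimes>\<^bsub>R\<^esub> snd y)),
      one = loc_frac R S \<one>\<^bsub>R\<^esub> \<one>\<^bsub>R\<^esub>,
      ring.zero = loc_frac R S \<zero>\<^bsub>R\<^esub> \<one>\<^bsub>R\<^esub>,
      add = (\<lambda>U V. \<Union>x\<in>U. \<Union>y\<in>V.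
               loc_frac R S ((fst x \<otimes>\<^bsub>R\<^esub> snd y) \<oplus>\<^bsub>R\<^esub> (fst y \<otimes>\<^bsub>R\<^esub> snd x)) (snd x \<otimes>\<^bsub>R\<^esub> snd y)) \<rparr>"

definition localization_at ::
    "('a, 'm) ring_scheme \<Rightarrow> 'a set \<Rightarrow> ('a \<times> 'a) set ring" where
  "localization_at R P = localization R (carrier R - P)"

text \<open>The residue field at a prime \<open>P\<close>, as the fraction field of \<open>R/P\<close>, with the canonical map
  from \<open>R\<close>.\<close>

definition residue_field ::
    "('a, 'm) ring_scheme \<Rightarrow> 'a set \<Rightarrow> ('a set \<times> 'a set) set ring" where
  "residue_field R P =
     localization (R Quot P) (carrier (R Quot P) - {\<zero>\<^bsub>R Quot P\<^esub>})"

definition residue_field_map ::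
    "('a, 'm) ring_scheme \<Rightarrow> 'a set \<Rightarrow> 'a \<Rightarrow> ('a set \<times> 'a set) set" where
  "residue_field_map R P a =
     loc_frac (R Quot P) (carrier (R Quot P) - {\<zero>\<^bsub>R Quot P\<^esub>}) (P +>\<^bsub>R\<^esub> a) \<one>\<^bsub>R Quot P\<^esub>"


subsection \<open>Completion\<close>

text \<open>The inverse limit of the rings \<open>R/I\<^sup>n\<close>; a coset of \<open>I\<^sup>n\<^sup>+\<^sup>1\<close> is mapped to the coset of \<open>I\<^sup>n\<close>
  that contains it.\<close>

definition completion :: "('a, 'm) ring_scheme \<Rightarrow> 'a set \<Rightarrow> (nat \<Rightarrow> 'a set) ring" where
  "completion R I = (let Q = (\<lambda>n::nat. R Quot (I [^]\<^bsub>ideals_set R\<^esub> n)) in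
    \<lparr> carrier = {x. (\<forall>n. x n \<in> carrier (Q n)) \<and> (\<forall>n. x (Suc n) \<subseteq> x n)},
      monoid.mult = (\<lambda>x y n. x n \<otimes>\<^bsub>Q n\<^esub> y n),
      one = (\<lambda>n. \<one>\<^bsub>Q n\<^esub>),
      ring.zero = (\<lambda>n. \<zero>\<^bsub>Q n\<^esub>),
      add = (\<lambda>x y n. x n \<oplus>\<^bsub>Q n\<^esub> y n) \<rparr>)"

definition completion_map :: "('a, 'm) ring_scheme \<Rightarrow> 'a set \<Rightarrow> 'a \<Rightarrow> nat \<Rightarrow> 'a set" where
  "completion_map R I a = (\<lambda>n::nat. (I [^]\<^bsub>ideals_set R\<^esub> n) +>\<^bsub>R\<^esub> a)"


subsection \<open>Polynomials in several indeterminates and tensor products\<close>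

text \<open>The library provides the elements of \<open>R[X\<^sub>i | i \<in> I]\<close> and their sum, but no product of
  two polynomials. Monomials are multisets over \<open>I\<close>.\<close>

definition mpoly_ring ::
    "('a, 'm) ring_scheme \<Rightarrow> 'i set \<Rightarrow> ('i multiset \<Rightarrow> 'a) ring" where
  "mpoly_ring R I =
    \<lparr> carrier = ring.indexed_pset R I (carrier R),
      monoid.mult = (\<lambda>f g m. finsum R (\<lambda>(u, v). f u \<otimes>\<^bsub>R\<^esub> g v) {(u, v). u + v = m}),
      one = ring.indexed_const R \<one>\<^bsub>R\<^esub>,
      ring.zero = ring.indexed_const R \<zero>\<^bsub>R\<^esub>,
      add = ring.indexed_padd R \<rparr>"

text \<open>For ring homomorphisms \<open>g : A \<rightarrow> B\<close> and \<open>h : A \<rightarrow> C\<close>, the commutative \<open>B\<close>-algebra \<open>B \<otimes>\<^sub>A C\<close>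
  presented by generators and relations: the indeterminate \<open>X\<^sub>c\<close> stands for \<open>1 \<otimes> c\<close>. (A
  \<open>B\<close>-algebra homomorphism from this quotient to \<open>D\<close> is the same as an \<open>A\<close>-algebra homomorphism
  from \<open>C\<close> to \<open>D\<close>.)\<close>

definition tensor_relations ::
    "('a, 'm) ring_scheme \<Rightarrow> ('b, 'n) ring_scheme \<Rightarrow> ('c, 'k) ring_scheme \<Rightarrow>
     ('a \<Rightarrow> 'b) \<Rightarrow> ('a \<Rightarrow> 'c) \<Rightarrow> ('c multiset \<Rightarrow> 'b) set" where
  "tensor_relations A B C g h = (let T = mpoly_ring B (carrier C); var = ring.indexed_var B in
     {var (c \<oplus>\<^bsub>C\<^esub> d) \<ominus>\<^bsub>T\<^esub> (var c \<oplus>\<^bsub>T\<^esub> var d) | c d. c \<in> carrier C \<and> d \<in> carrier C} \<union>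
     {var (c \<otimes>\<^bsub>C\<^esub> d) \<ominus>\<^bsub>T\<^esub> (var c \<otimes>\<^bsub>T\<^esub> var d) | c d. c \<in> carrier C \<and> d \<in> carrier C} \<union>
     {var (h a) \<ominus>\<^bsub>T\<^esub> ring.indexed_const B (g a) | a. a \<in> carrier A})"

definition tensor_algebra ::
    "('a, 'm) ring_scheme \<Rightarrow> ('b, 'n) ring_scheme \<Rightarrow> ('c, 'k) ring_scheme \<Rightarrow>
     ('a \<Rightarrow> 'b) \<Rightarrow> ('a \<Rightarrow> 'c) \<Rightarrow> ('c multiset \<Rightarrow> 'b) set ring" where
  "tensor_algebra A B C g h = (let T = mpoly_ring B (carrier C) in
     T Quot (genideal T (tensor_relations A B C g h)))"


subsection \<open>Regular rings\<close>

definition local_ring :: "('a, 'm) ring_scheme \<Rightarrow> bool" where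
  "local_ring R \<longleftrightarrow> cring R \<and> (\<exists>!M. maximalideal M R)"

definition max_ideal :: "('a, 'm) ring_scheme \<Rightarrow> 'a set" where
  "max_ideal R = (THE M. maximalideal M R)"

definition regular_local_ring :: "('a, 'm) ring_scheme \<Rightarrow> bool" where
  "regular_local_ring R \<longleftrightarrow> local_ring R \<and> noetherian_ring R \<and>
     (\<exists>B\<subseteq>carrier R. finite B \<and> max_ideal R = genideal R B \<and> enat (card B) = krull_dim R)"

definition regular_locus :: "('a, 'm) ring_scheme \<Rightarrow> 'a set set" where
  "regular_locus R = {P \<in> prime_spectrum R. regular_local_ring (localization_at R P)}"

definition regular_ring :: "('a, 'm) ring_scheme \<Rightarrow> bool" where
  "regular_ring R \<longleftrightarrow> cring R \<and> noetherian_ring R \<and> regular_locus R = prime_spectrum R"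

definition zariski_open :: "('a, 'm) ring_scheme \<Rightarrow> 'a set set \<Rightarrow> bool" where
  "zariski_open R U \<longleftrightarrow> (\<exists>I. ideal I R \<and> U = {P \<in> prime_spectrum R. \<not> I \<subseteq> P})"


section \<open>Excellent rings\<close>

text \<open>Up to isomorphism, the finitely generated \<open>R\<close>-algebras are the quotients of the polynomial
  rings \<open>R[X\<^sub>0, \<dots>, X\<^sub>n\<^sub>-\<^sub>1]\<close>.\<close>

definition universally_catenary :: "('a, 'm) ring_scheme \<Rightarrow> bool" where
  "universally_catenary R \<longleftrightarrow>
     (\<forall>(n::nat) I. ideal I (mpoly_ring R {..<n}) \<longrightarrow> catenary (mpoly_ring R {..<n} Quot I))"

definition J2_ring :: "('a, 'm) ring_scheme \<Rightarrow> bool" where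
  "J2_ring R \<longleftrightarrow>
     (\<forall>(n::nat) I. ideal I (mpoly_ring R {..<n}) \<longrightarrow>
        (let S = mpoly_ring R {..<n} Quot I in zariski_open S (regular_locus S)))"

text \<open>For a homomorphism \<open>f : A \<rightarrow> B\<close>: the fibre of \<open>f\<close> over each prime \<open>Q\<close> of \<open>A\<close> is
  geometrically regular, that is, \<open>B \<otimes>\<^sub>A L\<close> is regular for every finite field extension \<open>L\<close> of
  the residue field \<open>k\<close> of \<open>Q\<close>. Up to isomorphism these \<open>L\<close> are the rings
  \<open>k[X\<^sub>0, \<dots>, X\<^sub>n\<^sub>-\<^sub>1]/M\<close> with \<open>M\<close> maximal (they are finite over \<open>k\<close> by Zariski's lemma).\<close>

definition geometrically_regular_fibres ::
    "('a, 'm) ring_scheme \<Rightarrow> ('b, 'n) ring_scheme \<Rightarrow> ('a \<Rightarrow> 'b) \<Rightarrow> bool" where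
  "geometrically_regular_fibres A B f \<longleftrightarrow>
     (\<forall>Q\<in>prime_spectrum A. let k = residue_field A Q in
        \<forall>(n::nat) M. maximalideal M (mpoly_ring k {..<n}) \<longrightarrow>
          regular_ring (tensor_algebra A B (mpoly_ring k {..<n} Quot M) f
            (\<lambda>a. M +>\<^bsub>mpoly_ring k {..<n}\<^esub> ring.indexed_const k (residue_field_map A Q a))))"

text \<open>Flatness of the completion maps, which is part of the regularity of a homomorphism, is
  automatic for Noetherian local rings.\<close>

definition G_ring :: "('a, 'm) ring_scheme \<Rightarrow> bool" where
  "G_ring R \<longleftrightarrow> cring R \<and> noetherian_ring R \<and>
     (\<forall>P\<in>prime_spectrum R. let A = localization_at R P; m = max_ideal A in
        geometrically_regular_fibres A (completion A m) (completion_map A m))"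

definition excellent_ring :: "('a, 'm) ring_scheme \<Rightarrow> bool" where
  "excellent_ring R \<longleftrightarrow> cring R \<and> noetherian_ring R \<and>
     universally_catenary R \<and> G_ring R \<and> J2_ring R"


section \<open>Frobenius splittings\<close>

definition linear_map ::
    "('a, 'm) ring_scheme \<Rightarrow> ('a, 'b) module \<Rightarrow> ('a, 'c) module \<Rightarrow> ('b \<Rightarrow> 'c) \<Rightarrow> bool" where
  "linear_map R M N h \<longleftrightarrow> h \<in> carrier M \<rightarrow> carrier N \<and>
     (\<forall>x\<in>carrier M. \<forall>y\<in>carrier M. h (x \<oplus>\<^bsub>M\<^esub> y) = h x \<oplus>\<^bsub>N\<^esub> h y) \<and>
     (\<forall>r\<in>carrier R. \<forall>x\<in>carrier M. h (r \<odot>\<^bsub>M\<^esub> x) = r \<odot>\<^bsub>N\<^esub> h x)"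

definition module_splits ::
    "('a, 'm) ring_scheme \<Rightarrow> ('a, 'b) module \<Rightarrow> ('a, 'c) module \<Rightarrow> ('b \<Rightarrow> 'c) \<Rightarrow> bool" where
  "module_splits R M N h \<longleftrightarrow> (\<exists>g. linear_map R N M g \<and> (\<forall>x\<in>carrier M. g (h x) = x))"

definition finitely_generated_module ::
    "('a, 'm) ring_scheme \<Rightarrow> ('a, 'b) module \<Rightarrow> bool" where
  "finitely_generated_module R M \<longleftrightarrow> (\<exists>B\<subseteq>carrier M. finite B \<and>
     (\<forall>x\<in>carrier M. \<exists>c\<in>B \<rightarrow> carrier R. x = finsum M (\<lambda>b. c b \<odot>\<^bsub>M\<^esub> b) B))"

definition self_module :: "('a, 'm) ring_scheme \<Rightarrow> ('a, 'a) module" where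
  "self_module R =
    \<lparr> carrier = carrier R, monoid.mult = monoid.mult R, one = \<one>\<^bsub>R\<^esub>, ring.zero = \<zero>\<^bsub>R\<^esub>, add = add R,
      smult = monoid.mult R \<rparr>"

text \<open>The \<open>R\<close>-module \<open>R\<^sup>1\<^sup>/\<^sup>q\<close> with \<open>q = p\<^sup>e\<close>, where \<open>R\<close> is reduced of characteristic \<open>p\<close>. The element
  \<open>x\<close> of \<^term>\<open>carrier R\<close> stands for the root \<open>x\<^sup>1\<^sup>/\<^sup>q\<close>: the map sending \<open>x\<close> to \<open>x\<^sup>1\<^sup>/\<^sup>q\<close> is a ring isomorphism
  from \<open>R\<close> to \<open>R\<^sup>1\<^sup>/\<^sup>q\<close>, and as \<open>r = (r\<^sup>q)\<^sup>1\<^sup>/\<^sup>q\<close>, the inclusion of \<open>R\<close> in \<open>R\<^sup>1\<^sup>/\<^sup>q\<close> turns into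
  the Frobenius power sending \<open>r\<close> to \<open>r\<^sup>q\<close>.\<close>

definition frob_root :: "('a, 'm) ring_scheme \<Rightarrow> nat \<Rightarrow> nat \<Rightarrow> ('a, 'a) module" where
  "frob_root R p e =
    \<lparr> carrier = carrier R, monoid.mult = monoid.mult R, one = \<one>\<^bsub>R\<^esub>, ring.zero = \<zero>\<^bsub>R\<^esub>, add = add R,
      smult = (\<lambda>r x. (r [^]\<^bsub>R\<^esub> (p ^ e)) \<otimes>\<^bsub>R\<^esub> x) \<rparr>"

definition F_finite :: "('a, 'm) ring_scheme \<Rightarrow> nat \<Rightarrow> bool" where
  "F_finite R p \<longleftrightarrow> finitely_generated_module R (frob_root R p 1)"

text \<open>The \<open>R\<close>-linear map \<open>f\<^sup>1\<^sup>/\<^sup>q F\<^sup>e\<close> from \<open>R\<close> to \<open>R\<^sup>1\<^sup>/\<^sup>q\<close> that sends \<open>1\<close> to \<open>f\<^sup>1\<^sup>/\<^sup>q\<close>, \<open>q = p\<^sup>e\<close>.\<close>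

definition twisted_frob :: "('a, 'm) ring_scheme \<Rightarrow> nat \<Rightarrow> nat \<Rightarrow> 'a \<Rightarrow> 'a \<Rightarrow> 'a" where
  "twisted_frob R p e f = (\<lambda>r. r \<odot>\<^bsub>frob_root R p e\<^esub> f)"

definition twisted_frob_splits :: "('a, 'm) ring_scheme \<Rightarrow> nat \<Rightarrow> nat \<Rightarrow> 'a \<Rightarrow> bool" where
  "twisted_frob_splits R p e f \<longleftrightarrow>
     module_splits R (self_module R) (frob_root R p e) (twisted_frob R p e f)"


section \<open>Pairs and the F-pure threshold\<close>

text \<open>Powers of ideals are taken in \<^const>\<open>ideals_set\<close>, whose unit is the unit ideal. The
  exponents are nonnegative for \<open>s \<ge> 0\<close> and \<open>p \<ge> 1\<close>, so \<^const>\<open>nat\<close> does not truncate.\<close>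

definition F_pure_pair :: "('a, 'm) ring_scheme \<Rightarrow> nat \<Rightarrow> 'a set \<Rightarrow> real \<Rightarrow> bool" where
  "F_pure_pair R p I s \<longleftrightarrow>
     (\<forall>\<^sub>F e in sequentially.
        \<exists>f \<in> I [^]\<^bsub>ideals_set R\<^esub> nat \<lfloor>s * (real p ^ e - 1)\<rfloor>. twisted_frob_splits R p e f)"

definition sharply_F_pure_pair :: "('a, 'm) ring_scheme \<Rightarrow> nat \<Rightarrow> 'a set \<Rightarrow> real \<Rightarrow> bool" where
  "sharply_F_pure_pair R p I s \<longleftrightarrow>
     infinite {e. \<exists>f \<in> I [^]\<^bsub>ideals_set R\<^esub> nat \<lceil>s * (real p ^ e - 1)\<rceil>. twisted_frob_splits R p e f}"

text \<open>The supremum is taken in the extended reals, so it is \<open>\<infinity>\<close> for an unbounded set and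
  \<open>-\<infinity>\<close> for the empty set (the case that \<open>R\<close> is not F-pure).\<close>

definition fpt :: "('a, 'm) ring_scheme \<Rightarrow> nat \<Rightarrow> 'a set \<Rightarrow> ereal" where
  "fpt R p I = Sup (ereal ` {s. 0 \<le> s \<and> F_pure_pair R p I s})"

end

theory Submission
  imports Defs
begin

text \<open>Say that level \<open>e\<close> splits with exponent \<open>k\<close> if some \<open>f \<in> I\<^sup>k\<close> makes \<open>f\<^sup>1\<^sup>/\<^sup>q F\<^sup>e\<close>, \<open>q = p\<^sup>e\<close>, split.
  Composing the left inverses at two levels shows that exponents \<open>k\<^sub>1\<close> at level \<open>e\<^sub>1\<close> and \<open>k\<^sub>2\<close>
  at level \<open>e\<^sub>2\<close> give exponent \<open>k\<^sub>1 p\<^sup>e\<^sup>2 + k\<^sub>2\<close> at level \<open>e\<^sub>1 + e\<^sub>2\<close> (lemma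
  \<open>splits_with_exponent_add\<close>). Hence exponent \<open>K\<close> at one level \<open>d > 0\<close> gives
  exponent \<open>t (p\<^sup>n\<^sup>d - 1)\<close> at every level \<open>n d\<close>, where \<open>t = K / (p\<^sup>d - 1)\<close>.

  To reach the remaining levels \<open>e\<close>, write \<open>e = n d + r\<close> with \<open>r\<close> in a fixed window of
  length \<open>d\<close> on which some Frobenius splitting exists; a finite threshold provides one, as
  the set of exponents of F-pure pairs is then nonempty. The exponent reached at level \<open>e\<close> is
  \<open>t (p\<^sup>e - p\<^sup>r)\<close> with \<open>r\<close> bounded. For \<open>0 \<le> s < t\<close> this is at least \<open>s (p\<^sup>e - 1)\<close> as soon as \<open>e\<close> is
  large, so every such pair is F-pure and \<open>t\<close> is at most the threshold \<open>c\<close> (lemma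
  \<open>exponent_le_fpt\<close>).

  If the pair with exponent \<open>c\<close> is sharply F-pure, some level \<open>d > 0\<close> splits with exponent
  \<open>K = \<lceil>c (p\<^sup>d - 1)\<rceil>\<close>. Then \<open>t \<ge> c\<close> by the choice of \<open>K\<close>, and \<open>t \<le> c\<close> by the preceding bound,
  so \<open>c (p\<^sup>d - 1) = K\<close> is an integer.\<close>


section \<open>Composing Frobenius splittings\<close>

text \<open>In terms of elements of \<open>R\<close>, a left inverse is an additive, \<open>p\<^sup>-\<^sup>e\<close>-linear map taking \<open>f\<close>
  to \<open>1\<close>.\<close>

lemma (in cring) twisted_frob_splits_iff:
  assumes "f \<in> carrier R"
  shows "twisted_frob_splits R p e f \<longleftrightarrow>
    (\<exists>g \<in> carrier R \<rightarrow> carrier R.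
       (\<forall>x\<in>carrier R. \<forall>y\<in>carrier R. g (x \<oplus> y) = g x \<oplus> g y) \<and>
       (\<forall>r\<in>carrier R. \<forall>x\<in>carrier R. g (r [^] (p ^ e) \<otimes> x) = r \<otimes> g x) \<and>
       g f = \<one>)" (is "_ \<longleftrightarrow> (\<exists>g\<in>_. ?add g \<and> ?lin g \<and> g f = \<one>)")
proof -
  have "(\<forall>x\<in>carrier R. g (x [^] (p ^ e) \<otimes> f) = x) \<longleftrightarrow> g f = \<one>"
    if g: "g \<in> carrier R \<rightarrow> carrier R" "?lin g" for g
  proof
    assume "\<forall>x\<in>carrier R. g (x [^] (p ^ e) \<otimes> f) = x"
    then have "g (\<one> [^] (p ^ e) \<otimes> f) = \<one>" by blast
    then show "g f = \<one>" using assms by simp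
  next
    assume "g f = \<one>"
    then show "\<forall>x\<in>carrier R. g (x [^] (p ^ e) \<otimes> f) = x"
      using g assms by simp
  qed
  then show ?thesis
    unfolding twisted_frob_splits_def module_splits_def linear_map_def twisted_frob_def
      self_module_def frob_root_def
    by auto
qed

lemma (in cring) twisted_frob_splits_compose:
  assumes f: "f \<in> carrier R" "twisted_frob_splits R p e f"
    and h: "h \<in> carrier R" "twisted_frob_splits R p e' h"
  shows "twisted_frob_splits R p (e + e') (f [^] (p ^ e') \<otimes> h)"
proof -
  obtain g where g: "g \<in> carrier R \<rightarrow> carrier R" "g f = \<one>"
      "\<And>x y. x \<in> carrier R \<Longrightarrow> y \<in> carrier R \<Longrightarrow> g (x \<oplus> y) = g x \<oplus> g y"
      "\<And>r x. r \<in> carrier R \<Longrightarrow> x \<in> carrier R \<Longrightarrow> g (r [^] (p ^ e) \<otimes> x) = r \<otimes> g x"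
    using f(2) unfolding twisted_frob_splits_iff[OF f(1)] by blast
  obtain g' where g': "g' \<in> carrier R \<rightarrow> carrier R" "g' h = \<one>"
      "\<And>x y. x \<in> carrier R \<Longrightarrow> y \<in> carrier R \<Longrightarrow> g' (x \<oplus> y) = g' x \<oplus> g' y"
      "\<And>r x. r \<in> carrier R \<Longrightarrow> x \<in> carrier R \<Longrightarrow> g' (r [^] (p ^ e') \<otimes> x) = r \<otimes> g' x"
    using h(2) unfolding twisted_frob_splits_iff[OF h(1)] by blast
  note closed = funcset_mem[OF g(1)] funcset_mem[OF g'(1)]
  have lin: "g (g' (r [^] (p ^ (e + e')) \<otimes> x)) = r \<otimes> g (g' x)"
    if "r \<in> carrier R" "x \<in> carrier R" for r x
  proof -
    have "r [^] (p ^ (e + e')) = (r [^] (p ^ e)) [^] (p ^ e')"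
      using that by (simp add: nat_pow_pow power_add)
    then show ?thesis
      using that closed g(4) g'(4) by simp
  qed
  have "f [^] (p ^ e') \<otimes> h \<in> carrier R" using f h by simp
  moreover have "g (g' (f [^] (p ^ e') \<otimes> h)) = \<one>"
    using f h g(2) g'(2,4) by simp
  ultimately show ?thesis
    using lin closed g(3) g'(3)
    by (subst twisted_frob_splits_iff) (auto intro!: bexI[of _ "\<lambda>x. g (g' x)"])
qed


section \<open>Exponents reached by Frobenius splittings\<close>

lemma (in cring) ideals_set_pow_is_ideal:
  assumes "ideal I R"
  shows "ideal (I [^]\<^bsub>ideals_set R\<^esub> (k::nat)) R"
proof -
  interpret S: semiring "ideals_set R" by (rule ideals_set_is_semiring)
  have "I [^]\<^bsub>ideals_set R\<^esub> k \<in> carrier (ideals_set R)"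
    using assms by (intro S.nat_pow_closed) (simp add: ideals_set_def)
  then show ?thesis by (simp add: ideals_set_def)
qed

lemma (in cring) ideals_set_pow_add:
  assumes "ideal I R"
  shows "I [^]\<^bsub>ideals_set R\<^esub> (k + l :: nat)
    = (I [^]\<^bsub>ideals_set R\<^esub> k) \<cdot> (I [^]\<^bsub>ideals_set R\<^esub> l)"
proof -
  interpret S: semiring "ideals_set R" by (rule ideals_set_is_semiring)
  show ?thesis
    using S.nat_pow_mult[of I k l] assms by (simp add: ideals_set_def)
qed

lemma (in cring) mult_in_ideals_set_pow:
  assumes "ideal I R"
    and "x \<in> I [^]\<^bsub>ideals_set R\<^esub> (k::nat)" and "y \<in> I [^]\<^bsub>ideals_set R\<^esub> (l::nat)"
  shows "x \<otimes> y \<in> I [^]\<^bsub>ideals_set R\<^esub> (k + l)"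
  unfolding ideals_set_pow_add[OF assms(1)] using assms(2,3) by (rule ideal_prod.prod)

lemma (in cring) pow_in_ideals_set_pow:
  assumes "ideal I R" and "x \<in> I [^]\<^bsub>ideals_set R\<^esub> (k::nat)"
  shows "x [^] (n::nat) \<in> I [^]\<^bsub>ideals_set R\<^esub> (k * n)"
proof (induction n)
  case 0
  show ?case by (simp add: ideals_set_def)
next
  case (Suc n)
  then show ?case
    using mult_in_ideals_set_pow[OF assms(1) Suc assms(2)] by (simp add: add.commute)
qed

lemma (in cring) ideals_set_pow_antimono:
  assumes "ideal I R" and "(k::nat) \<le> l"
  shows "I [^]\<^bsub>ideals_set R\<^esub> l \<subseteq> I [^]\<^bsub>ideals_set R\<^esub> k"
proof -
  obtain m where "l = k + m" using le_Suc_ex[OF assms(2)] by blast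
  then show ?thesis
    using ideal_prod_inter[OF assms(1)[THEN ideals_set_pow_is_ideal]
        assms(1)[THEN ideals_set_pow_is_ideal]]
    by (simp add: ideals_set_pow_add[OF assms(1)])
qed

text \<open>Some \<open>f \<in> I\<^sup>k\<close> makes \<open>f\<^sup>1\<^sup>/\<^sup>q F\<^sup>e\<close> split, where \<open>q = p\<^sup>e\<close>.\<close>

definition splits_with_exponent ::
    "('a, 'm) ring_scheme \<Rightarrow> nat \<Rightarrow> 'a set \<Rightarrow> nat \<Rightarrow> nat \<Rightarrow> bool" where
  "splits_with_exponent R p I e k \<longleftrightarrow>
     (\<exists>f \<in> I [^]\<^bsub>ideals_set R\<^esub> k. twisted_frob_splits R p e f)"

lemma (in cring) splits_with_exponent_antimono:
  assumes "ideal I R" "splits_with_exponent R p I e l" "k \<le> l"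
  shows "splits_with_exponent R p I e k"
  using assms(2) ideals_set_pow_antimono[OF assms(1,3)]
  unfolding splits_with_exponent_def by blast

lemma (in cring) splits_with_exponent_zero:
  "splits_with_exponent R p I 0 0"
proof -
  have "twisted_frob_splits R p 0 \<one>"
    by (subst twisted_frob_splits_iff) (auto intro!: bexI[of _ "\<lambda>x. x"])
  then show ?thesis
    by (auto simp: splits_with_exponent_def ideals_set_def)
qed

lemma (in cring) splits_with_exponent_add:
  assumes I: "ideal I R"
    and "splits_with_exponent R p I e k" "splits_with_exponent R p I e' k'"
  shows "splits_with_exponent R p I (e + e') (k * p ^ e' + k')"
proof -
  obtain f h where f: "f \<in> I [^]\<^bsub>ideals_set R\<^esub> k" "twisted_frob_splits R p e f"
    and h: "h \<in> I [^]\<^bsub>ideals_set R\<^esub> k'" "twisted_frob_splits R p e' h"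
    using assms unfolding splits_with_exponent_def by blast
  have "f \<in> carrier R" "h \<in> carrier R"
    using f h ideal.Icarr[OF ideals_set_pow_is_ideal[OF I]] by auto
  then have "twisted_frob_splits R p (e + e') (f [^] (p ^ e') \<otimes> h)"
    using f h twisted_frob_splits_compose by blast
  moreover have "f [^] (p ^ e') \<otimes> h \<in> I [^]\<^bsub>ideals_set R\<^esub> (k * p ^ e' + k')"
    using I f h by (intro mult_in_ideals_set_pow pow_in_ideals_set_pow)
  ultimately show ?thesis unfolding splits_with_exponent_def by blast
qed

lemma (in cring) splits_with_exponent_iterate:
  assumes "ideal I R" "splits_with_exponent R p I d k"
  shows "splits_with_exponent R p I (n * d) (k * (\<Sum>i<n. (p ^ d) ^ i))"
proof (induction n)
  case 0
  show ?case by (simp add: splits_with_exponent_zero)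
next
  case (Suc n)
  have "splits_with_exponent R p I (d + n * d)
      (k * p ^ (n * d) + k * (\<Sum>i<n. (p ^ d) ^ i))"
    using assms Suc by (rule splits_with_exponent_add)
  moreover have "p ^ (n * d) = (p ^ d) ^ n"
    by (simp add: power_mult mult.commute)
  ultimately show ?case by (simp add: algebra_simps)
qed


section \<open>Comparison with the F-pure threshold\<close>

lemma (in cring) F_pure_pair_of_exponent:
  assumes I: "ideal I R" and p: "p \<ge> 2" and d: "d > 0"
    and K: "splits_with_exponent R p I d K"
    and pure: "\<And>e. e \<ge> N \<Longrightarrow> splits_with_exponent R p I e 0"
    and s: "0 \<le> s" "s < real K / (real p ^ d - 1)"
  shows "F_pure_pair R p I s"
proof -
  define t where "t = real K / (real p ^ d - 1)"
  have pd: "real p ^ d > 1" using p d by simp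
  have st: "s < t" using s by (simp add: t_def)
  obtain M where M: "t * real p ^ (N + d) / (t - s) < real p ^ M"
    using real_arch_pow[of "real p"] p by auto
  have "\<forall>\<^sub>F e in sequentially. t * real p ^ (N + d) / (t - s) \<le> real p ^ e"
    using eventually_ge_at_top[of M]
  proof eventually_elim
    case (elim e)
    then have "real p ^ M \<le> real p ^ e" using p by (intro power_increasing) auto
    then show ?case using M by simp
  qed
  moreover have "\<forall>\<^sub>F e in sequentially. N \<le> e"
    by (rule eventually_ge_at_top)
  ultimately have "\<forall>\<^sub>F e in sequentially.
      splits_with_exponent R p I e (nat \<lfloor>s * (real p ^ e - 1)\<rfloor>)"
  proof eventually_elim
    case (elim e)
    define n r where "n = (e - N) div d" and "r = N + (e - N) mod d"
    have e: "e = n * d + r" using elim by (simp add: n_def r_def)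
    have r: "N \<le> r" "r \<le> N + d"
      using d less_imp_le[OF mod_less_divisor[of d "e - N"]] by (simp_all add: r_def)
    have pe: "real p ^ e = (real p ^ d) ^ n * real p ^ r"
      unfolding e power_add by (simp add: mult.commute[of n d] power_mult)
    define k where "k = K * (\<Sum>i<n. (p ^ d) ^ i) * p ^ r"
    have "splits_with_exponent R p I (n * d + r) (K * (\<Sum>i<n. (p ^ d) ^ i) * p ^ r + 0)"
      by (intro splits_with_exponent_add splits_with_exponent_iterate I K pure r)
    then have k: "splits_with_exponent R p I e k" by (simp add: e k_def)
    have "(real p ^ d - 1) * (\<Sum>i<n. (real p ^ d) ^ i) = (real p ^ d) ^ n - 1"
      by (rule power_diff_1_eq[symmetric])
    then have "(\<Sum>i<n. (real p ^ d) ^ i) = ((real p ^ d) ^ n - 1) / (real p ^ d - 1)"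
      using pd by (simp add: field_simps)
    then have "real k = t * ((real p ^ d) ^ n - 1) * real p ^ r"
      by (simp add: k_def t_def)
    also have "\<dots> = t * (real p ^ e - real p ^ r)"
      by (simp add: pe algebra_simps)
    finally have k_eq: "real k = t * (real p ^ e - real p ^ r)" .
    have "real p ^ r \<le> real p ^ (N + d)"
      using p r by (intro power_increasing) auto
    then have "t * real p ^ r \<le> t * real p ^ (N + d)"
      using s st by (intro mult_left_mono) auto
    also have "\<dots> \<le> (t - s) * real p ^ e"
      using elim st by (simp add: field_simps)
    finally have "s * (real p ^ e - 1) \<le> real k"
      using s by (simp add: k_eq algebra_simps)
    then have "nat \<lfloor>s * (real p ^ e - 1)\<rfloor> \<le> k"
      by linarith
    then show ?case using splits_with_exponent_antimono I k by blast
  qed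
  then show ?thesis
    unfolding F_pure_pair_def splits_with_exponent_def .
qed

lemma (in cring) exponent_le_fpt:
  assumes I: "ideal I R" and p: "p \<ge> 2" and d: "d > 0"
    and K: "splits_with_exponent R p I d K"
    and c: "fpt R p I = ereal c"
  shows "real K / (real p ^ d - 1) \<le> c"
proof -
  have upper: "s \<le> c" if "0 \<le> s" "F_pure_pair R p I s" for s
  proof -
    have "ereal s \<le> fpt R p I"
      unfolding fpt_def using that by (intro Sup_upper) auto
    then show ?thesis using c by simp
  qed
  \<comment> \<open>The supremum of the empty set is \<open>-\<infinity>\<close>.\<close>
  have "{s. 0 \<le> s \<and> F_pure_pair R p I s} \<noteq> {}"
  proof
    assume empty: "{s. 0 \<le> s \<and> F_pure_pair R p I s} = {}"
    have "fpt R p I = -\<infinity>"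
      unfolding fpt_def empty by (simp add: bot_ereal_def)
    then show False using c by simp
  qed
  then obtain s where s: "0 \<le> s" "F_pure_pair R p I s" by blast
  then have c0: "0 \<le> c" using upper by force
  obtain N where "\<And>e. e \<ge> N \<Longrightarrow>
      splits_with_exponent R p I e (nat \<lfloor>s * (real p ^ e - 1)\<rfloor>)"
    using s(2) unfolding F_pure_pair_def splits_with_exponent_def eventually_sequentially
    by blast
  then have pure: "splits_with_exponent R p I e 0" if "e \<ge> N" for e
    using splits_with_exponent_antimono[OF I] that by blast
  show "real K / (real p ^ d - 1) \<le> c"
  proof (rule ccontr)
    assume "\<not> real K / (real p ^ d - 1) \<le> c"
    then obtain u where "c < u" "u < real K / (real p ^ d - 1)"
      using dense[of c "real K / (real p ^ d - 1)"] by (auto simp: not_le)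
    then have "F_pure_pair R p I u"
      using c0 by (intro F_pure_pair_of_exponent[OF I p d K pure]) auto
    then show False using upper[of u] \<open>c < u\<close> c0 by simp
  qed
qed


section \<open>Sharp F-purity at the threshold\<close>

theorem corollary5p4:
  fixes R :: "('a, 'm) ring_scheme" and p :: nat and I :: "'a set" and c :: real
  assumes "cring R"
    and "noetherian_ring R"
    and "excellent_ring R"
    and "reduced_ring R"
    and "p > 0"
    and "contains_field_of_char R p"
    and "F_finite R p"
    and "ideal I R"
    and "I \<inter> off_minimal_primes R \<noteq> {}"
    and "fpt R p I = ereal c"
    and "sharply_F_pure_pair R p I c"
  shows "c \<in> \<rat> \<and>
    (\<exists>e::nat. e > 0 \<and> c * (real p ^ e - 1) \<in> \<int>) \<and>
    (\<exists>m n :: int. n \<noteq> 0 \<and> c = real_of_int m / real_of_int n \<and> \<not> int p dvd n)"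
proof -
  interpret cring R by fact
  obtain K where "subfield K R" and char: "\<And>n::nat. [n] \<cdot>\<^bsub>R\<^esub> \<one>\<^bsub>R\<^esub> = \<zero>\<^bsub>R\<^esub> \<longleftrightarrow> p dvd n"
    using assms(6) unfolding contains_field_of_char_def by blast
  then have "\<one>\<^bsub>R\<^esub> \<noteq> \<zero>\<^bsub>R\<^esub>"
    using subdomain.sub_one_not_zero[OF subfield.axioms(1)] by blast
  then have "p \<noteq> 1" using char[of 1] by auto
  then have p: "p \<ge> 2" using assms(5) by simp
  have "infinite {e. splits_with_exponent R p I e (nat \<lceil>c * (real p ^ e - 1)\<rceil>)}"
    using assms(11) unfolding sharply_F_pure_pair_def splits_with_exponent_def .
  \<comment> \<open>Level \<open>0\<close> always splits with exponent \<open>0\<close> and carries no information, so a positive level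
    is chosen.\<close>
  then obtain d k where d: "d > 0" and k_def: "k = nat \<lceil>c * (real p ^ d - 1)\<rceil>"
    and k: "splits_with_exponent R p I d k"
    unfolding infinite_nat_iff_unbounded by blast
  note le = exponent_le_fpt[OF assms(8) p d k assms(10)]
  have pd: "real p ^ d > 1" using p d by simp
  have "real k \<le> c * (real p ^ d - 1)"
    using le pd by (simp add: field_simps)
  moreover have "c * (real p ^ d - 1) \<le> real k"
    unfolding k_def by (rule real_nat_ceiling_ge)
  ultimately have eq: "c * (real p ^ d - 1) = real k" by simp
  then have int: "c * (real p ^ d - 1) \<in> \<int>" by simp
  define n where "n = int p ^ d - 1"
  have n: "real_of_int n = real p ^ d - 1" by (simp add: n_def)
  then have "n \<noteq> 0" using pd by auto
  moreover have quot: "c = real_of_int (int k) / real_of_int n"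
    using eq pd by (simp add: n field_simps)
  moreover have "\<not> int p dvd n"
  proof
    assume "int p dvd n"
    moreover have "int p dvd int p ^ d" using d by simp
    ultimately have "int p dvd int p ^ d - n" by (rule dvd_diff[rotated])
    then have "int p dvd 1" by (simp add: n_def)
    then show False using p by simp
  qed
  moreover have "c \<in> \<rat>" by (subst quot) simp
  ultimately show ?thesis using int d by blast
qed

end
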